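(* Let $n,N\ge 1$, let $(\mathbf{x}^{(i)},y^{(i)})_{i=1}^N \subseteq \mathbb{R}^n\times\mathbb{R}$ be a dataset with $\mathbf{y}=(y^{(1)},\dots,y^{(N)})^\top$, let $W\subseteq\mathbb{Z}^n_{\ge 0}$ be a finite set containing $\mathbf{0}$, and let $\mathbf{X}\in\mathbb{R}^{N\times|W|}$ be the matrix with entries $\mathbf{X}_{i,\mathbf{w}}=\mathbf{w}^\top\mathbf{x}^{(i)}$. Let $(\mathbf{p}^k,\mathbf{q}^k)_{k\ge 0}$ be the iterates of the alternating minimization algorithm described in the context. Then the error $$e^k=\|\mathbf{X}\boxplus\mathbf{p}^k-\mathbf{X}\boxplus\mathbf{q}^k-\mathbf{y}\|_\infty$$ is nonincreasing in $k$, i.e. $e^{k+1}\le e^k$ for every $k\ge 0$.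
   Context: Max-plus and min-plus matrix-vector products: for an $m\times r$ matrix $\mathbf{A}$ and a vector $\mathbf{u}$ of length $r$, $(\mathbf{A}\boxplus\mathbf{u})_i=\max_{1\le j\le r}(a_{i,j}+u_j)$ and $(\mathbf{A}\boxplus'\mathbf{u})_i=\min_{1\le j\le r}(a_{i,j}+u_j)$. Adding a scalar to a vector means adding it to every entry. Entries of vectors may be $-\infty$, with $a+(-\infty)=-\infty$. Alternating minimization algorithm (input: dataset and $W$). Columns of $\mathbf{X}$ and coefficient vectors $\mathbf{p}=(p_\mathbf{w})_{\mathbf{w}\in W}$, $\mathbf{q}=(q_\mathbf{w})_{\mathbf{w}\in W}$ are indexed by $W$. Initialize all entries of $\mathbf{p}^0$ and $\mathbf{q}^0$ to $-\infty$, except $q^0_{\mathbf{0}}=-\frac1N\sum_{i=1}^N y^{(i)}$. For $k=1,2,\dots$ set $$\mathbf{p}^k\in\arg\min_{\mathbf{p}}\|\mathbf{X}\boxplus\mathbf{p}-\mathbf{X}\boxplus\mathbf{q}^{k-1}-\mathbf{y}\|_\infty,\qquad \mathbf{q}^k\in\arg\min_{\mathbf{q}}\|\mathbf{X}\boxplus\mathbf{p}^k-\mathbf{X}\boxplus\mathbf{q}-\mathbf{y}\|_\infty,$$ where the minimizer chosen is the closed-form one: a minimizer of $\|\mathbf{X}\boxplus\mathbf{u}-\mathbf{b}\|_\infty$ over $\mathbf{u}$ is $\hat{\mathbf{u}}+\frac12\|\mathbf{X}\boxplus\hat{\mathbf{u}}-\mathbf{b}\|_\infty$ with $\hat{\mathbf{u}}=(-\mathbf{X}^\top)\boxplus'\mathbf{b}$;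 it is applied with $\mathbf{b}=\mathbf{X}\boxplus\mathbf{q}^{k-1}+\mathbf{y}$ to obtain $\mathbf{p}^k$ and with $\mathbf{b}=\mathbf{X}\boxplus\mathbf{p}^k-\mathbf{y}$ to obtain $\mathbf{q}^k$. All entries of $\mathbf{p}^k,\mathbf{q}^k$ are finite for $k\ge 1$; for $k=0$ one has $\mathbf{X}\boxplus\mathbf{p}^0=-\infty$ and $e^0=+\infty$. *)

theory Defs
  imports "HOL-Analysis.Analysis"
begin

text \<open>
  Matrices and vectors are functions of their indices. Vectors have entries in \<^typ>\<open>ereal\<close>, because
  the initial iterates have entries \<open>-\<infinity>\<close>. Operations that range over all entries take
  the finite index set as an argument; values outside it are irrelevant.
\<close>

definition max_plus :: "'j set \<Rightarrow> ('i \<Rightarrow> 'j \<Rightarrow> real) \<Rightarrow> ('j \<Rightarrow> ereal) \<Rightarrow> 'i \<Rightarrow> ereal" where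
  "max_plus J A u i = (MAX j\<in>J. ereal (A i j) + u j)"

definition min_plus :: "'j set \<Rightarrow> ('i \<Rightarrow> 'j \<Rightarrow> real) \<Rightarrow> ('j \<Rightarrow> ereal) \<Rightarrow> 'i \<Rightarrow> ereal" where
  "min_plus J A u i = (MIN j\<in>J. ereal (A i j) + u j)"

text \<open>The value is \<open>\<infinity>\<close> as soon as one of the entries is \<open>\<infinity>\<close> or \<open>-\<infinity>\<close>.\<close>
definition sup_norm :: "'i set \<Rightarrow> ('i \<Rightarrow> ereal) \<Rightarrow> ereal" where
  "sup_norm I v = (MAX i\<in>I. \<bar>v i\<bar>)"

text \<open>
  The closed-form minimizer of \<open>\<parallel>A \<boxplus> u - b\<parallel>\<close> over \<open>u\<close>, for \<open>A\<close> with row index set \<open>I\<close> and column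
  index set \<open>J\<close>: the principal solution \<open>(-A\<^sup>T) \<boxplus>' b\<close>, shifted by half of its residual.
\<close>
definition principal_solution ::
    "'i set \<Rightarrow> ('i \<Rightarrow> 'j \<Rightarrow> real) \<Rightarrow> ('i \<Rightarrow> ereal) \<Rightarrow> 'j \<Rightarrow> ereal" where
  "principal_solution I A b = min_plus I (\<lambda>j i. - A i j) b"

definition closed_form_minimizer ::
    "'i set \<Rightarrow> 'j set \<Rightarrow> ('i \<Rightarrow> 'j \<Rightarrow> real) \<Rightarrow> ('i \<Rightarrow> ereal) \<Rightarrow> 'j \<Rightarrow> ereal" where
  "closed_form_minimizer I J A b =
     (let u = principal_solution I A b
      in (\<lambda>j. u j + ereal (1 / 2) * sup_norm I (\<lambda>i. max_plus J A u i - b i)))"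

definition data_matrix :: "(nat \<Rightarrow> real ^ 'n) \<Rightarrow> nat \<Rightarrow> nat ^ 'n \<Rightarrow> real" where
  "data_matrix x i w = (\<chi> l. real (w $ l)) \<bullet> x i"

text \<open>
  The pair \<open>(p\<^sup>k, q\<^sup>k)\<close> of iterates for the data points \<open>(x i, y i)\<close>, \<open>i = 1, \<dots>, N\<close>, with the
  coefficient vectors indexed by the exponent vectors in \<open>W\<close>.
\<close>
primrec alt_min ::
    "nat \<Rightarrow> (nat \<Rightarrow> real ^ 'n) \<Rightarrow> (nat \<Rightarrow> real) \<Rightarrow> (nat ^ 'n) set \<Rightarrow> nat
      \<Rightarrow> (nat ^ 'n \<Rightarrow> ereal) \<times> (nat ^ 'n \<Rightarrow> ereal)" where
  "alt_min N x y W 0 =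
     (\<lambda>w. -\<infinity>,
      \<lambda>w. if w = 0 then ereal (- (1 / real N) * (\<Sum>i=1..N. y i)) else -\<infinity>)"
| "alt_min N x y W (Suc k) =
     (let X = data_matrix x;
          q = snd (alt_min N x y W k);
          p' = closed_form_minimizer {1..N} W X (\<lambda>i. max_plus W X q i + ereal (y i));
          q' = closed_form_minimizer {1..N} W X (\<lambda>i. max_plus W X p' i - ereal (y i))
      in (p', q'))"

definition alt_min_error ::
    "nat \<Rightarrow> (nat \<Rightarrow> real ^ 'n) \<Rightarrow> (nat \<Rightarrow> real) \<Rightarrow> (nat ^ 'n) set \<Rightarrow> nat \<Rightarrow> ereal" where
  "alt_min_error N x y W k =
     (let X = data_matrix x; (p, q) = alt_min N x y W k
      in sup_norm {1..N} (\<lambda>i. max_plus W X p i - max_plus W X q i - ereal (y i)))"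

end

theory Submission
  imports Defs
begin

text \<open>
  The principal solution \<open>u\<close> is the largest vector with \<open>A \<boxplus> u \<le> b\<close>. Any competitor \<open>v\<close> with
  residual \<open>r\<close> satisfies \<open>v \<le> u + r\<close>, so \<open>A \<boxplus> u\<close> lies between \<open>b - 2r\<close> and \<open>b\<close>; shifting \<open>u\<close> by
  half of its own residual therefore gives an error of at most \<open>r\<close>. Each half step of the
  algorithm is such a minimization, up to the sign of the residual, of the error of the current
  pair, as soon as \<open>X \<boxplus> q\<close> is finite, which holds for all \<open>k\<close> including \<open>k = 0\<close>.
\<close>

lemma max_plus_le_iff:
  assumes "finite J" "J \<noteq> {}"
  shows "max_plus J A u i \<le> c \<longleftrightarrow> (\<forall>j\<in>J. ereal (A i j) + u j \<le> c)"
  using assms by (simp add: max_plus_def)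

lemma max_plus_ge:
  assumes "finite J" "j \<in> J"
  shows "ereal (A i j) + u j \<le> max_plus J A u i"
  using assms by (simp add: max_plus_def)

lemma sup_norm_le_iff:
  assumes "finite I" "I \<noteq> {}"
  shows "sup_norm I v \<le> c \<longleftrightarrow> (\<forall>i\<in>I. \<bar>v i\<bar> \<le> c)"
  using assms by (simp add: sup_norm_def)

lemma max_plus_ereal:
  assumes "finite J" "J \<noteq> {}"
  shows "max_plus J A (\<lambda>j. ereal (u j)) = (\<lambda>i. ereal (MAX j\<in>J. A i j + u j))"
  using assms by (simp add: fun_eq_iff max_plus_def mono_Max_commute[of ereal] mono_def image_image)

lemma min_plus_ereal:
  assumes "finite J" "J \<noteq> {}"
  shows "min_plus J A (\<lambda>j. ereal (u j)) = (\<lambda>i. ereal (MIN j\<in>J. A i j + u j))"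
  using assms by (simp add: fun_eq_iff min_plus_def mono_Min_commute[of ereal] mono_def image_image)

lemma sup_norm_ereal:
  assumes "finite I" "I \<noteq> {}"
  shows "sup_norm I (\<lambda>i. ereal (v i)) = ereal (MAX i\<in>I. \<bar>v i\<bar>)"
  using assms by (simp add: sup_norm_def mono_Max_commute[of ereal] mono_def image_image)

text \<open>Real data give a real minimizer, so infinite entries can occur only in the initial
  pair.\<close>

lemma closed_form_minimizer_ereal:
  assumes "finite I" "I \<noteq> {}" "finite J" "J \<noteq> {}"
  obtains u where "closed_form_minimizer I J A (\<lambda>i. ereal (b i)) = (\<lambda>j. ereal (u j))"
  using assms
  by (simp add: closed_form_minimizer_def principal_solution_def min_plus_ereal max_plus_ereal
      sup_norm_ereal Let_def)

text \<open>The competitor \<open>v\<close> is an arbitrary \<open>ereal\<close> vector because it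
  has to cover the initial vectors, which have entries \<open>-\<infinity>\<close>.\<close>

lemma closed_form_minimizer_optimal:
  fixes b :: "'i \<Rightarrow> real"
  assumes I: "finite I" "I \<noteq> {}" and J: "finite J" "J \<noteq> {}"
  shows "sup_norm I (\<lambda>i. max_plus J A (closed_form_minimizer I J A (\<lambda>i. ereal (b i))) i - ereal (b i))
    \<le> sup_norm I (\<lambda>i. max_plus J A v i - ereal (b i))" (is "_ \<le> ?e")
proof (cases "?e = \<infinity>")
  case False
  obtain i0 where "i0 \<in> I" using I by auto
  then have "0 \<le> ?e"
    using order_trans[OF abs_ereal_pos] sup_norm_le_iff[OF I, of _ ?e] by blast
  then obtain r where r: "?e = ereal r"
    using False by (cases ?e) auto
  define u where "u j = (MIN i\<in>I. - A i j + b i)" for j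
  define d where "d = (MAX i\<in>I. \<bar>(MAX j\<in>J. A i j + u j) - b i\<bar>)"
  have u: "principal_solution I A (\<lambda>i. ereal (b i)) = (\<lambda>j. ereal (u j))"
    by (simp add: principal_solution_def min_plus_ereal[OF I] u_def)
  have cf: "closed_form_minimizer I J A (\<lambda>i. ereal (b i)) = (\<lambda>j. ereal (u j + d / 2))"
    by (simp add: closed_form_minimizer_def u Let_def max_plus_ereal[OF J] sup_norm_ereal[OF I] d_def)
  have res: "\<bar>max_plus J A v i - ereal (b i)\<bar> \<le> ereal r" if "i \<in> I" for i
    using that sup_norm_le_iff[OF I, THEN iffD1, OF eq_refl[OF r]] by blast
  have v_le: "v j \<le> ereal (u j + r)" if "j \<in> J" for j
  proof -
    \<comment> \<open>A finite residual makes row \<open>i\<close> of the product with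
      \<open>v\<close> real, hence excludes \<open>v j = \<infinity>\<close>; the value
      \<open>-\<infinity>\<close> remains possible and is harmless.\<close>
    have "v j \<le> ereal (- A i j + b i + r)" if "i \<in> I" for i
      using res[OF that] max_plus_ge[OF J(1) \<open>j \<in> J\<close>, of A i v]
      by (cases "v j"; cases "max_plus J A v i") auto
    moreover obtain i where "i \<in> I" "u j = - A i j + b i"
      using Min_in[of "(\<lambda>i. - A i j + b i) ` I"] I unfolding u_def by blast
    ultimately show ?thesis by metis
  qed
  have upper: "(MAX j\<in>J. A i j + u j) \<le> b i" if "i \<in> I" for i
  proof -
    have "u j \<le> - A i j + b i" for j
      unfolding u_def using I that by (intro Min_le) auto
    then show ?thesis using J by (auto simp: algebra_simps)
  qed
  \<comment> \<open>One \<open>r\<close> is lost in passing from \<open>b\<close> to the product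
    with \<open>v\<close>, the other in replacing \<open>v\<close> by the larger
    \<open>u + r\<close>.\<close>
  have lower: "b i - 2 * r \<le> (MAX j\<in>J. A i j + u j)" if "i \<in> I" for i
  proof -
    have "max_plus J A v i \<le> ereal ((MAX j\<in>J. A i j + u j) + r)"
    proof (subst max_plus_le_iff[OF J], rule ballI)
      fix j assume "j \<in> J"
      have "A i j + u j \<le> (MAX j\<in>J. A i j + u j)"
        using J \<open>j \<in> J\<close> by (intro Max_ge) auto
      then show "ereal (A i j) + v j \<le> ereal ((MAX j\<in>J. A i j + u j) + r)"
        using v_le[OF \<open>j \<in> J\<close>] by (cases "v j") auto
    qed
    then show ?thesis using res[OF that] by (cases "max_plus J A v i") auto
  qed
  have "\<bar>(MAX j\<in>J. A i j + u j) - b i\<bar> \<le> 2 * r" if "i \<in> I" for i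
    using upper[OF that] lower[OF that] by linarith
  then have "d \<le> 2 * r"
    unfolding d_def using I by simp
  \<comment> \<open>The unshifted residuals lie in \<open>[-d, 0]\<close>; the shift by
    \<open>d / 2\<close> centres this interval at 0, and \<open>d / 2 \<le> r\<close>.\<close>
  have "\<bar>(MAX j\<in>J. A i j + (u j + d / 2)) - b i\<bar> \<le> r" if "i \<in> I" for i
  proof -
    have "(MAX j\<in>J. A i j + (u j + d / 2)) = (MAX j\<in>J. A i j + u j) + d / 2"
      using Max_add_commute[OF J, of "\<lambda>j. A i j + u j" "d / 2"] by (simp add: add.assoc)
    moreover have "\<bar>(MAX j\<in>J. A i j + u j) - b i\<bar> \<le> d"
      unfolding d_def using I that by (intro Max_ge) auto
    ultimately show ?thesis using upper[OF that] \<open>d \<le> 2 * r\<close> by linarith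
  qed
  then show ?thesis
    unfolding cf r by (subst sup_norm_le_iff[OF I]) (simp add: max_plus_ereal[OF J])
qed simp

lemma alt_min_snd_finite:
  assumes "N \<ge> 1" and "finite W" and "0 \<in> W"
  obtains Q where "max_plus W (data_matrix x) (snd (alt_min N x y W k)) = (\<lambda>i. ereal (Q i))"
proof -
  let ?X = "data_matrix x" and ?I = "{1..N}"
  have I: "finite ?I" "?I \<noteq> {}" and W: "finite W" "W \<noteq> {}" using assms by auto
  have "\<exists>Q. max_plus W ?X (snd (alt_min N x y W k)) = (\<lambda>i. ereal (Q i))"
  proof (induction k)
    case 0
    let ?c = "- (1 / real N) * (\<Sum>i=1..N. y i)"
    \<comment> \<open>Every column except \<open>0\<close> contributes \<open>-\<infinity>\<close>,
      so the maximum is attained at \<open>0\<close>, which lies in \<open>W\<close>.\<close>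
    have "max_plus W ?X (snd (alt_min N x y W 0)) i = ereal (?X i 0 + ?c)" for i
    proof (rule antisym)
      show "max_plus W ?X (snd (alt_min N x y W 0)) i \<le> ereal (?X i 0 + ?c)"
        by (subst max_plus_le_iff[OF W]) auto
      show "ereal (?X i 0 + ?c) \<le> max_plus W ?X (snd (alt_min N x y W 0)) i"
        using max_plus_ge[OF assms(2,3), of ?X i "snd (alt_min N x y W 0)"] by simp
    qed
    then show ?case by fast
  next
    case (Suc k)
    then obtain Q where Q: "max_plus W ?X (snd (alt_min N x y W k)) = (\<lambda>i. ereal (Q i))" ..
    obtain p where p: "closed_form_minimizer ?I W ?X (\<lambda>i. ereal (Q i + y i)) = (\<lambda>j. ereal (p j))"
      by (rule closed_form_minimizer_ereal[OF I W])
    obtain q where q: "closed_form_minimizer ?I W ?X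
        (\<lambda>i. ereal ((MAX j\<in>W. ?X i j + p j) - y i)) = (\<lambda>j. ereal (q j))"
      by (rule closed_form_minimizer_ereal[OF I W])
    have "snd (alt_min N x y W (Suc k)) = (\<lambda>j. ereal (q j))"
      by (simp add: Let_def Q p max_plus_ereal[OF W] q del: One_nat_def)
    then show ?case by (auto simp: max_plus_ereal[OF W])
  qed
  then show ?thesis using that by blast
qed

theorem proposition3p1:
  fixes x :: "nat \<Rightarrow> real ^ 'n" and y :: "nat \<Rightarrow> real" and W :: "(nat ^ 'n) set" and N k :: nat
  assumes "N \<ge> 1" and "finite W" and "0 \<in> W"
  shows "alt_min_error N x y W (Suc k) \<le> alt_min_error N x y W k"
proof -
  let ?X = "data_matrix x" and ?I = "{1..N}"
  have I: "finite ?I" "?I \<noteq> {}" and W: "finite W" "W \<noteq> {}" using assms by auto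
  define p where "p = fst (alt_min N x y W k)"
  define q where "q = snd (alt_min N x y W k)"
  obtain Q where Q: "max_plus W ?X q = (\<lambda>i. ereal (Q i))"
    unfolding q_def by (rule alt_min_snd_finite[OF assms])
  define p' where "p' = closed_form_minimizer ?I W ?X (\<lambda>i. ereal (Q i + y i))"
  obtain u where "p' = (\<lambda>j. ereal (u j))"
    unfolding p'_def by (rule closed_form_minimizer_ereal[OF I W])
  then obtain P' where P': "max_plus W ?X p' = (\<lambda>i. ereal (P' i))"
    using that max_plus_ereal[OF W, of ?X u] by simp
  define q' where "q' = closed_form_minimizer ?I W ?X (\<lambda>i. ereal (P' i - y i))"
  have iter: "alt_min N x y W (Suc k) = (p', q')"
    using Q P' by (simp add: Let_def q_def p'_def q'_def)
  obtain Q' where Q': "max_plus W ?X q' = (\<lambda>i. ereal (Q' i))"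
    using alt_min_snd_finite[OF assms, of x y "Suc k"] unfolding iter by auto
  \<comment> \<open>Both products are real here, so the residual \<open>P' - Q' - y\<close> is the
    negative of \<open>Q' - (P' - y)\<close>, and the absolute values agree.\<close>
  have "alt_min_error N x y W (Suc k)
      = sup_norm ?I (\<lambda>i. max_plus W ?X q' i - ereal (P' i - y i))"
    unfolding alt_min_error_def iter
    by (auto simp: Let_def P' Q' sup_norm_def intro!: arg_cong[where f = Max] image_cong)
  also have "\<dots> \<le> sup_norm ?I (\<lambda>i. max_plus W ?X q i - ereal (P' i - y i))"
    unfolding q'_def by (rule closed_form_minimizer_optimal[OF I W])
  \<comment> \<open>The error of the mixed pair \<open>(p', q)\<close> is read in two ways:
    \<open>q\<close> competes with \<open>q'\<close> for the target \<open>P' - y\<close>, and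
    \<open>p'\<close> is optimal for the target \<open>Q + y\<close>.\<close>
  also have "\<dots> = sup_norm ?I (\<lambda>i. max_plus W ?X p' i - ereal (Q i + y i))"
    by (auto simp: P' Q sup_norm_def intro!: arg_cong[where f = Max] image_cong)
  also have "\<dots> \<le> sup_norm ?I (\<lambda>i. max_plus W ?X p i - ereal (Q i + y i))"
    unfolding p'_def by (rule closed_form_minimizer_optimal[OF I W])
  also have "\<dots> = alt_min_error N x y W k"
  proof -
    \<comment> \<open>Here \<open>a\<close> stands for a row of the product with \<open>p\<close>,
      which is \<open>-\<infinity>\<close> when \<open>k = 0\<close>.\<close>
    have "a - ereal (Q i + y i) = a - ereal (Q i) - ereal (y i)" for a i
      by (cases a) auto
    then show ?thesis
      by (simp add: alt_min_error_def Let_def case_prod_beta Q p_def flip: q_def)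
  qed
  finally show ?thesis .
qed

end
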